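(* Let $\theta>0$, $\lambda>0$, $T>0$, $\Delta t>0$ be real numbers, let $n\ge 1$ be an integer with $n\Delta t\le T$, and let $$L=\max\{1/\theta,\,2\},\qquad M=e^{2L\lambda T}.$$ Let $C(w_0,z_0,z_1,z_2)$ be the companion matrix (defined in the context) of the third adaptation of the Modified Craig--Sneyd scheme with parameter $\theta$, and let $\|\cdot\|$ be the maximum norm for matrices. Consider the condition $$|z_0|\le 2\sqrt{\operatorname{Re} z_1\,\operatorname{Re} z_2}\quad\text{and}\quad \operatorname{Re} z_1\le 0,\ \operatorname{Re} z_2\le 0. \qquad ( * )$$ (a) If $\theta\ge\frac13$, then $\|C(w_0,z_0,z_1,z_2)^n\|\le M$ whenever $w_0\in\mathbb{C}$ with $|w_0|\le\lambda\Delta t$ and $z_0,z_1,z_2\in\mathbb{R}$ satisfy $( * )$. (b) If $\frac12\le\theta\le 1$, then $\|C(w_0,z_0,z_1,z_2)^n\|\le M$ whenever $w_0\in\mathbb{C}$ with $|w_0|\le\lambda\Delta t$ and $z_0,z_1,z_2\in\mathbb{C}$ satisfy $( * )$.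
   Context: $\operatorname{Re}$ denotes the real part. The maximum norm for matrices is the operator norm induced by the maximum vector norm, i.e. the maximum absolute row sum. For a real parameter $\theta>0$ and complex numbers $w_0,z_0,z_1,z_2$, put $$z=w_0+z_0+z_1+z_2,\qquad p=(1-\theta z_1)(1-\theta z_2),$$ $$T_1(w_0,z_0,z_1,z_2)=1+\left(z+\tfrac12 w_0\right)\left(\frac1p+\theta\frac{z_0}{p^2}+\left(\tfrac12-\theta\right)\frac{z_0+z_1+z_2}{p^2}\right),$$ $$T_0(w_0,z_0,z_1,z_2)=-\tfrac12 w_0\left(\frac1p+\theta\frac{z_0}{p^2}+\left(\tfrac12-\theta\right)\frac{z_0+z_1+z_2}{p^2}\right),$$ $$C(w_0,z_0,z_1,z_2)=\begin{pmatrix}T_1(w_0,z_0,z_1,z_2)&T_0(w_0,z_0,z_1,z_2)\\1&0\end{pmatrix}.$$ The matrix $C$ is the companion matrix of the recurrence $U_n=T_1U_{n-1}+T_0U_{n-2}$ obtained by applying the third adaptation of the Modified Craig--Sneyd scheme with parameter $\theta$ (integral term treated in a two-step Adams--Bashforth fashion) to the scalar test equation $\dot U=(\lambda_0+\mu_0+\mu_1+\mu_2)U$ with step size $\Delta t$, where $w_0=\lambda_0\Delta t$ and $z_j=\mu_j\Delta t$ for $j=0,1,2$. *)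

theory Defs
  imports "HOL-Analysis.Analysis"
begin

(* On type 'a^'n^'n the overloaded "^" is the componentwise power, since "*" is the
   componentwise product; the power with respect to the matrix product is needed here. *)
definition matpow :: "'a::semiring_1 ^ 'n ^ 'n \<Rightarrow> nat \<Rightarrow> 'a ^ 'n ^ 'n" where
  "matpow A n = (((**) A) ^^ n) (mat 1)"

(* Not infnorm: on complex^'n that one maximises over real and imaginary parts separately. *)
definition vec_maxnorm :: "'a::real_normed_vector ^ 'n \<Rightarrow> real" where
  "vec_maxnorm x = (MAX i. norm (x $ i))"

(* Same shape as onorm: the vector x = 0 contributes 0 / 0 = 0. *)
definition mat_maxnorm :: "'a::real_normed_field ^ 'n ^ 'm \<Rightarrow> real" where
  "mat_maxnorm A = (SUP x. vec_maxnorm (A *v x) / vec_maxnorm x)"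

lemma norm_nth_le_vec_maxnorm: "norm (x $ i) \<le> vec_maxnorm x"
  unfolding vec_maxnorm_def by (intro Max_ge) auto

lemma vec_maxnorm_le: "(\<And>i. norm (x $ i) \<le> b) \<Longrightarrow> vec_maxnorm x \<le> b"
  unfolding vec_maxnorm_def by (intro Max.boundedI) auto

lemma mat_maxnorm_eq_row_sum:
  fixes A :: "'a::real_normed_field ^ 'n ^ 'm"
  shows "mat_maxnorm A = (MAX i. \<Sum>j\<in>UNIV. norm (A $ i $ j))"
proof -
  define r where "r i = (\<Sum>j\<in>UNIV. norm (A $ i $ j))" for i
  define R where "R = (MAX i. r i)"
  have r_le: "r i \<le> R" for i
    unfolding R_def by (intro Max_ge) auto
  have r_nonneg: "0 \<le> r i" for i
    unfolding r_def by (intro sum_nonneg) auto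
  have "R \<in> range r"
    unfolding R_def by (intro Max_in) auto
  then obtain k where k: "R = r k"
    by auto
  have R_nonneg: "0 \<le> R"
    using k r_nonneg by simp
  have vn: "0 \<le> vec_maxnorm x" for x :: "'a ^ 'n"
    using norm_nth_le_vec_maxnorm norm_ge_zero order_trans by blast
  have upper: "vec_maxnorm (A *v x) / vec_maxnorm x \<le> R" for x
  proof (cases "vec_maxnorm x = 0")
    case True
    then show ?thesis using R_nonneg by simp
  next
    case False
    then have pos: "0 < vec_maxnorm x"
      using vn[of x] by linarith
    have "vec_maxnorm (A *v x) \<le> R * vec_maxnorm x"
    proof (rule vec_maxnorm_le)
      fix i
      have "norm ((A *v x) $ i) \<le> (\<Sum>j\<in>UNIV. norm (A $ i $ j * x $ j))"
        unfolding matrix_vector_mult_def by (simp add: norm_sum)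
      also have "\<dots> \<le> (\<Sum>j\<in>UNIV. norm (A $ i $ j) * vec_maxnorm x)"
        by (intro sum_mono) (simp add: norm_mult mult_left_mono norm_nth_le_vec_maxnorm)
      also have "\<dots> = r i * vec_maxnorm x"
        by (simp add: r_def sum_distrib_right)
      also have "\<dots> \<le> R * vec_maxnorm x"
        by (intro mult_right_mono r_le vn)
      finally show "norm ((A *v x) $ i) \<le> R * vec_maxnorm x" .
    qed
    then show ?thesis
      using pos by (simp add: pos_divide_le_eq)
  qed
  define y :: "'a ^ 'n" where
    "y = (\<chi> j. if A $ k $ j = 0 then 1 else of_real (norm (A $ k $ j)) / A $ k $ j)"
  have y_nth: "norm (y $ j) = 1" for j
    by (simp add: y_def norm_divide)
  have y1: "vec_maxnorm y = 1"
    unfolding vec_maxnorm_def by (simp add: y_nth)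
  have "(A *v y) $ k = (\<Sum>j\<in>UNIV. of_real (norm (A $ k $ j)))"
    unfolding matrix_vector_mult_def by (auto simp: y_def intro!: sum.cong)
  also have "\<dots> = of_real (r k)"
    by (simp add: r_def)
  finally have "norm ((A *v y) $ k) = R"
    using k r_nonneg[of k] by simp
  then have "R \<le> vec_maxnorm (A *v y)"
    using norm_nth_le_vec_maxnorm[of "A *v y" k] by simp
  then have "R \<le> vec_maxnorm (A *v y) / vec_maxnorm y"
    by (simp add: y1)
  also have "\<dots> \<le> mat_maxnorm A"
    unfolding mat_maxnorm_def
    by (rule cSUP_upper) (use upper in \<open>auto intro!: bdd_aboveI[of _ R]\<close>)
  finally have "R \<le> mat_maxnorm A" .
  moreover have "mat_maxnorm A \<le> R"
    unfolding mat_maxnorm_def by (rule cSUP_least) (use upper in auto)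
  ultimately have "mat_maxnorm A = R"
    by (rule order.antisym[rotated])
  then show ?thesis
    unfolding R_def r_def .
qed

definition mcs_p :: "real \<Rightarrow> complex \<Rightarrow> complex \<Rightarrow> complex" where
  "mcs_p \<theta> z1 z2 = (1 - of_real \<theta> * z1) * (1 - of_real \<theta> * z2)"

(* T_1 and T_0 depend on the scheme only through this common factor; the z_j are step size
   times the eigenvalue of the j-th split part, w_0 that of the integral part. *)
definition mcs_factor :: "real \<Rightarrow> complex \<Rightarrow> complex \<Rightarrow> complex \<Rightarrow> complex" where
  "mcs_factor \<theta> z0 z1 z2 =
     1 / mcs_p \<theta> z1 z2 + of_real \<theta> * (z0 / (mcs_p \<theta> z1 z2)\<^sup>2)
       + (1/2 - of_real \<theta>) * ((z0 + z1 + z2) / (mcs_p \<theta> z1 z2)\<^sup>2)"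

definition mcs_T1 :: "real \<Rightarrow> complex \<Rightarrow> complex \<Rightarrow> complex \<Rightarrow> complex \<Rightarrow> complex" where
  "mcs_T1 \<theta> w0 z0 z1 z2 =
     1 + ((w0 + z0 + z1 + z2) + 1/2 * w0) * mcs_factor \<theta> z0 z1 z2"

definition mcs_T0 :: "real \<Rightarrow> complex \<Rightarrow> complex \<Rightarrow> complex \<Rightarrow> complex \<Rightarrow> complex" where
  "mcs_T0 \<theta> w0 z0 z1 z2 = - (1/2) * w0 * mcs_factor \<theta> z0 z1 z2"

(* Companion matrix of U_n = T_1 U_(n-1) + T_0 U_(n-2): the Modified Craig-Sneyd scheme with
   the integral term treated by two-step Adams-Bashforth, applied to the scalar equation
   U' = (lambda_0 + mu_0 + mu_1 + mu_2) U. *)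
definition mcs_companion ::
    "real \<Rightarrow> complex \<Rightarrow> complex \<Rightarrow> complex \<Rightarrow> complex \<Rightarrow> complex ^ 2 ^ 2" where
  "mcs_companion \<theta> w0 z0 z1 z2 =
     vector [vector [mcs_T1 \<theta> w0 z0 z1 z2, mcs_T0 \<theta> w0 z0 z1 z2],
             vector [1, 0]]"

definition mcs_cond :: "complex \<Rightarrow> complex \<Rightarrow> complex \<Rightarrow> bool" where
  "mcs_cond z0 z1 z2 \<longleftrightarrow>
     cmod z0 \<le> 2 * sqrt (Re z1 * Re z2) \<and> Re z1 \<le> 0 \<and> Re z2 \<le> 0"

end

theory Submission
  imports Defs
begin

text \<open>
  With \<open>W = - \<theta> (z1 + z2)\<close>, \<open>V = - \<theta> (z0 + z1 + z2)\<close>, \<open>\<kappa> = 1 / (2 \<theta>)\<close> and \<open>S\<close> the common factor of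
  \<open>T1\<close> and \<open>T0\<close>, one has \<open>S = (p + W - \<kappa> V) / p\<^sup>2\<close>, and the stability function of the underlying
  scheme is \<open>R = 1 + (z0 + z1 + z2) S = 1 - 2 \<kappa> V (p + W - \<kappa> V) / p\<^sup>2\<close>. Since \<open>T1 = R + 3/2 w0 S\<close>
  and \<open>T0 = - 1/2 w0 S\<close>, it suffices to show \<open>|R| \<le> 1\<close> and \<open>|S| \<le> 2\<close>: then one step expands the
  maximum norm by at most \<open>1 + 4 |w0| \<le> exp (2 L |w0|)\<close>.

  For real \<open>z\<close>, \<open>|R| \<le> 1\<close> is the AM-GM inequality for the factors \<open>\<kappa> V\<close> and \<open>p + W - \<kappa> V\<close>, because
  \<open>W \<le> p\<close>. For complex \<open>z\<close>, the Cayley-type variables \<open>c = (1 + \<theta> z1) (1 + \<theta> z2) / p\<close> and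
  \<open>e = 2 \<theta> z0 / p\<close> turn the condition on the \<open>z\<close> into \<open>|c| + |e| \<le> 1\<close> and \<open>R\<close> into a quadratic
  polynomial in \<open>c\<close> and \<open>e\<close>, whose coefficients for powers of \<open>e\<close> can be estimated separately.
\<close>

section \<open>Growth of powers of the companion matrix in the maximum norm\<close>

lemma mat_maxnorm_matpow_le:
  fixes A :: "'a::real_normed_field ^ 'n ^ 'n"
  assumes "0 \<le> K" and A: "\<And>x. vec_maxnorm (A *v x) \<le> K * vec_maxnorm x"
  shows "mat_maxnorm (matpow A n) \<le> K ^ n"
proof -
  have pow: "vec_maxnorm (matpow A n *v x) \<le> K ^ n * vec_maxnorm x" for x
  proof (induction n)
    case 0
    show ?case by (simp add: matpow_def)
  next
    case (Suc n)
    have "vec_maxnorm (matpow A (Suc n) *v x) = vec_maxnorm (A *v (matpow A n *v x))"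
      by (simp add: matpow_def matrix_vector_mul_assoc)
    also have "\<dots> \<le> K * vec_maxnorm (matpow A n *v x)"
      by (rule A)
    also have "\<dots> \<le> K * (K ^ n * vec_maxnorm x)"
      by (intro mult_left_mono Suc.IH \<open>0 \<le> K\<close>)
    finally show ?case by (simp add: mult.assoc)
  qed
  have "vec_maxnorm (matpow A n *v x) / vec_maxnorm x \<le> K ^ n" for x
  proof (cases "vec_maxnorm x = 0")
    case True
    then show ?thesis using \<open>0 \<le> K\<close> by simp
  next
    case False
    moreover have "0 \<le> vec_maxnorm x"
      using norm_nth_le_vec_maxnorm norm_ge_zero order_trans by blast
    ultimately show ?thesis
      using pow[of x] by (simp add: pos_divide_le_eq)
  qed
  then show ?thesis
    unfolding mat_maxnorm_def by (intro cSUP_least) auto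
qed

text \<open>The two row sums are \<open>norm a + norm b\<close> and 1; the second one forces
  \<open>1 \<le> K\<close>.\<close>

lemma vec_maxnorm_companion_le:
  fixes a b :: "'a::real_normed_field"
  assumes "norm a + norm b \<le> K" "1 \<le> K"
  shows "vec_maxnorm ((vector [vector [a, b], vector [1, 0]] :: 'a ^ 2 ^ 2) *v x) \<le> K * vec_maxnorm x"
proof (rule vec_maxnorm_le)
  fix i :: 2
  let ?C = "vector [vector [a, b], vector [1, 0]] :: 'a ^ 2 ^ 2"
  have nonneg: "0 \<le> vec_maxnorm x"
    using norm_nth_le_vec_maxnorm norm_ge_zero order_trans by blast
  have "norm (a * x $ 1 + b * x $ 2) \<le> norm a * norm (x $ 1) + norm b * norm (x $ 2)"
    by (metis norm_mult norm_triangle_ineq)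
  also have "\<dots> \<le> norm a * vec_maxnorm x + norm b * vec_maxnorm x"
    by (intro add_mono mult_left_mono norm_nth_le_vec_maxnorm) auto
  also have "\<dots> \<le> K * vec_maxnorm x"
    using mult_right_mono[OF assms(1) nonneg] by (simp add: distrib_right)
  finally have "norm ((?C *v x) $ 1) \<le> K * vec_maxnorm x"
    by (simp add: matrix_vector_mult_def sum_2 vector_2)
  moreover have "norm (x $ 1) \<le> K * vec_maxnorm x"
    using norm_nth_le_vec_maxnorm[of x 1] mult_right_mono[OF assms(2) nonneg] by simp
  then have "norm ((?C *v x) $ 2) \<le> K * vec_maxnorm x"
    by (simp add: matrix_vector_mult_def sum_2 vector_2)
  ultimately show "norm ((?C *v x) $ i) \<le> K * vec_maxnorm x"
    using exhaust_2[of i] by auto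
qed

lemma mcs_companion_matpow_le:
  assumes R: "cmod (1 + (z0 + z1 + z2) * mcs_factor \<theta> z0 z1 z2) \<le> 1"
    and S: "cmod (mcs_factor \<theta> z0 z1 z2) \<le> L"
    and w: "cmod w0 \<le> d"
  shows "mat_maxnorm (matpow (mcs_companion \<theta> w0 z0 z1 z2) n) \<le> exp (2 * L * (real n * d))"
proof -
  define S where "S = mcs_factor \<theta> z0 z1 z2"
  have L0: "0 \<le> L" and d0: "0 \<le> d"
    using S w norm_ge_zero order_trans by blast+
  have wS: "cmod w0 * cmod S \<le> L * d"
    unfolding mult.commute[of L] using S w d0 by (intro mult_mono) (auto simp: S_def)
  have "mcs_T1 \<theta> w0 z0 z1 z2 = (1 + (z0 + z1 + z2) * S) + 3/2 * (w0 * S)"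
    by (simp add: mcs_T1_def S_def algebra_simps)
  then have "cmod (mcs_T1 \<theta> w0 z0 z1 z2) \<le> 1 + 3/2 * (cmod w0 * cmod S)"
    using norm_triangle_ineq[of "1 + (z0 + z1 + z2) * S" "3/2 * (w0 * S)"] R
    by (simp add: norm_mult S_def)
  moreover have "cmod (mcs_T0 \<theta> w0 z0 z1 z2) = 1/2 * (cmod w0 * cmod S)"
    by (simp add: mcs_T0_def norm_mult S_def)
  \<comment> \<open>The weights 3/2 in \<open>T1\<close> and 1/2 in \<open>T0\<close> add up to the
    2 in the exponent.\<close>
  ultimately have T: "cmod (mcs_T1 \<theta> w0 z0 z1 z2) + cmod (mcs_T0 \<theta> w0 z0 z1 z2) \<le> 1 + 2 * L * d"
    using wS by linarith
  have "mat_maxnorm (matpow (mcs_companion \<theta> w0 z0 z1 z2) n) \<le> (1 + 2 * L * d) ^ n"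
    using T L0 d0
    by (intro mat_maxnorm_matpow_le) (simp_all add: mcs_companion_def vec_maxnorm_companion_le)
  also have "\<dots> \<le> exp (2 * L * d) ^ n"
    using L0 d0 by (intro power_mono exp_ge_add_one_self) auto
  also have "\<dots> = exp (2 * L * (real n * d))"
    by (simp flip: exp_of_nat_mult add: ac_simps)
  finally show ?thesis .
qed

section \<open>Reduction to scaled variables\<close>

lemma mcs_factor_scaled:
  fixes \<theta> :: real and z0 z1 z2 :: complex
  assumes "\<theta> > 0"
  defines "\<kappa> \<equiv> complex_of_real (1 / (2 * \<theta>))"
    and "W \<equiv> - (of_real \<theta> * (z1 + z2))"
    and "V \<equiv> - (of_real \<theta> * (z0 + z1 + z2))"
    and "P \<equiv> mcs_p \<theta> z1 z2"
  shows "mcs_factor \<theta> z0 z1 z2 = (P + W - \<kappa> * V) / P\<^sup>2"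
    and "1 + (z0 + z1 + z2) * mcs_factor \<theta> z0 z1 z2 = 1 - 2 * (\<kappa> * V) * (P + W - \<kappa> * V) / P\<^sup>2"
proof -
  have \<kappa>V: "2 * (\<kappa> * V) = - (z0 + z1 + z2)"
    using \<open>\<theta> > 0\<close> by (simp add: \<kappa>_def V_def field_simps)
  have N: "P + W - \<kappa> * V = P + of_real \<theta> * z0 + (1/2 - of_real \<theta>) * (z0 + z1 + z2)"
  proof -
    have half: "\<kappa> * V = - (z0 + z1 + z2) / 2"
      unfolding \<kappa>V[symmetric] by simp
    show ?thesis
      unfolding W_def half by (simp add: field_simps)
  qed
  \<comment> \<open>This includes \<open>P = 0\<close>, where both sides are 0 by the convention for
    division.\<close>
  have "1 / P = P / P\<^sup>2"
    by (simp add: power2_eq_square)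
  then show S: "mcs_factor \<theta> z0 z1 z2 = (P + W - \<kappa> * V) / P\<^sup>2"
    unfolding N mcs_factor_def P_def[symmetric]
    by (simp only: times_divide_eq_right) (simp only: add_divide_distrib)
  show "1 + (z0 + z1 + z2) * mcs_factor \<theta> z0 z1 z2 = 1 - 2 * (\<kappa> * V) * (P + W - \<kappa> * V) / P\<^sup>2"
    unfolding S \<kappa>V
    by (simp only: mult_minus_left minus_divide_left[symmetric] diff_minus_eq_add times_divide_eq_right)
qed

section \<open>Real eigenvalues\<close>

lemma mcs_real_bounds:
  fixes x y u \<kappa> :: real
  assumes x: "0 \<le> x" and y: "0 \<le> y" and u: "\<bar>u\<bar> \<le> 2 * sqrt (x * y)"
    and \<kappa>: "0 \<le> \<kappa>" "\<kappa> \<le> 3/2"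
  defines "P \<equiv> (1 + x) * (1 + y)" and "W \<equiv> x + y" and "V \<equiv> x + y - u"
  shows "\<bar>(P + W - \<kappa> * V) / P\<^sup>2\<bar> \<le> 2"
    and "\<bar>1 - 2 * (\<kappa> * V) * (P + W - \<kappa> * V) / P\<^sup>2\<bar> \<le> 1"
proof -
  define g where "g = sqrt (x * y)"
  define N where "N = P + W - \<kappa> * V"
  have g2: "g\<^sup>2 = x * y" and gW: "2 * g \<le> W"
    using x y arith_geo_mean_sqrt[of x y] by (auto simp: g_def W_def)
  have P: "P = 1 + W + x * y"
    by (simp add: P_def W_def algebra_simps)
  have xy: "0 \<le> x * y" and W0: "0 \<le> W"
    using x y by (auto simp: W_def)
  have P1: "1 \<le> P" and WP: "W \<le> P"
    using P xy W0 by auto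
  have V0: "0 \<le> V" and VW: "V \<le> W + 2 * g"
    using u gW by (auto simp: V_def W_def g_def)
  have \<kappa>V0: "0 \<le> \<kappa> * V"
    using \<kappa> V0 by simp
  have "\<kappa> * V \<le> 3/2 * (W + 2 * g)"
    using \<kappa> V0 VW by (intro mult_mono) auto
  \<comment> \<open>Since \<open>P = 1 + W + g\<^sup>2\<close>, the bound on
    \<open>\<kappa> * V\<close> gives \<open>N \<ge> 1 + W/2 - 3 * g + g\<^sup>2\<close>, and
    \<open>W \<ge> 2 * g\<close> completes the square. For \<open>\<kappa> = 3/2\<close> equality is
    possible: \<open>x = y = 1\<close>, \<open>u = -2\<close> gives \<open>N = 0\<close>.\<close>
  then have "N \<ge> (1 - g)\<^sup>2"
    using gW g2 unfolding N_def P by (simp add: power2_diff)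
  then have N0: "0 \<le> N"
    by (meson order_trans zero_le_power2)
  have "P \<le> P\<^sup>2"
    using P1 by (simp add: power2_eq_square)
  moreover have "N \<le> 2 * P"
    using \<kappa>V0 WP by (simp add: N_def)
  ultimately have "N \<le> 2 * P\<^sup>2"
    by simp
  then show "\<bar>(P + W - \<kappa> * V) / P\<^sup>2\<bar> \<le> 2"
    using N0 P1 unfolding N_def[symmetric] by (simp add: pos_divide_le_eq)
  \<comment> \<open>The two factors add up to \<open>P + W\<close>, hence to at most
    \<open>2 * P\<close>, so their product is at most \<open>P\<^sup>2\<close>.\<close>
  have "4 * ((\<kappa> * V) * N) \<le> (\<kappa> * V + N)\<^sup>2"
    using zero_le_power2[of "\<kappa> * V - N"] by (simp add: power2_eq_square algebra_simps)
  also have "\<dots> \<le> (2 * P)\<^sup>2"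
    using \<kappa>V0 N0 WP by (intro power_mono) (auto simp: N_def)
  finally have "(\<kappa> * V) * N \<le> P\<^sup>2"
    by simp
  then have "(\<kappa> * V) * N / P\<^sup>2 \<le> 1"
    using P1 by (simp add: pos_divide_le_eq)
  moreover have "0 \<le> (\<kappa> * V) * N / P\<^sup>2"
    using \<kappa>V0 N0 by simp
  ultimately show "\<bar>1 - 2 * (\<kappa> * V) * (P + W - \<kappa> * V) / P\<^sup>2\<bar> \<le> 1"
    unfolding N_def[symmetric] by (simp add: abs_if mult.assoc)
qed

section \<open>Complex eigenvalues\<close>

text \<open>Among all \<open>c\<close> of a given modulus, the positive real one maximises the
  modulus of the polynomial. Squares are compared, which is legitimate because
  \<open>G \<le> B\<close> keeps the right-hand side nonnegative on the unit disc.\<close>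

lemma norm_quadratic_le:
  fixes c :: complex and A B G :: real
  assumes "0 \<le> A" "0 \<le> B" "0 \<le> G" "4 * A * G + B * G \<le> A * B" "G \<le> B" and c: "cmod c \<le> 1"
  shows "cmod (of_real A + of_real B * c - of_real G * c\<^sup>2) \<le> A + B * cmod c - G * (cmod c)\<^sup>2"
proof -
  define \<rho> x y where "\<rho> = cmod c" and "x = Re c" and "y = Im c"
  have \<rho>: "0 \<le> \<rho>" "\<rho> \<le> 1" and x: "x \<le> \<rho>"
    using c complex_Re_le_cmod by (auto simp: \<rho>_def x_def)
  have \<rho>2: "\<rho>\<^sup>2 = x\<^sup>2 + y\<^sup>2"
    by (simp add: \<rho>_def x_def y_def cmod_power2)
  have \<rho>2_le: "\<rho>\<^sup>2 \<le> \<rho>"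
    using \<rho> by (simp add: power2_eq_square mult_left_le)
  have "cmod (of_real A + of_real B * c - of_real G * c\<^sup>2) ^ 2
      = (A + B * x - G * (x\<^sup>2 - y\<^sup>2))\<^sup>2 + (B * y - G * (2 * x * y))\<^sup>2"
    unfolding cmod_power2 by (simp add: x_def y_def power2_eq_square algebra_simps)
  \<comment> \<open>The defect vanishes at \<open>x = \<rho>\<close>, so \<open>\<rho> - x\<close>
    splits off. As \<open>\<rho> + x \<le> 2\<close> and \<open>\<rho>\<^sup>2 \<le> 1\<close>, the
    cofactor is at least \<open>A * B - 4 * A * G - B * G\<close>, which is where the fourth
    hypothesis enters.\<close>
  also have "\<dots> = (A + B * \<rho> - G * \<rho>\<^sup>2)\<^sup>2
      - 2 * ((\<rho> - x) * (A * B - 2 * A * G * (\<rho> + x) - B * G * \<rho>\<^sup>2))"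
  proof -
    have y2: "y\<^sup>2 = \<rho>\<^sup>2 - x\<^sup>2"
      using \<rho>2 by simp
    have "(A + B * x - G * (x\<^sup>2 - y\<^sup>2))\<^sup>2 + (B * y - G * (2 * x * y))\<^sup>2
        = (A + B * x - G * (x\<^sup>2 - y\<^sup>2))\<^sup>2 + (B - 2 * G * x)\<^sup>2 * y\<^sup>2"
      by (simp add: power2_eq_square algebra_simps)
    also have "\<dots> = (A + B * \<rho> - G * \<rho>\<^sup>2)\<^sup>2
      - 2 * ((\<rho> - x) * (A * B - 2 * A * G * (\<rho> + x) - B * G * \<rho>\<^sup>2))"
      unfolding y2 by (simp add: power2_eq_square algebra_simps)
    finally show ?thesis .
  qed
  also have "\<dots> \<le> (A + B * \<rho> - G * \<rho>\<^sup>2)\<^sup>2"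
  proof -
    have "2 * (A * G) * (\<rho> + x) \<le> 2 * (A * G) * 2"
      using \<rho> x assms by (intro mult_left_mono) auto
    moreover have "(B * G) * \<rho>\<^sup>2 \<le> (B * G) * 1"
      using \<rho> \<rho>2_le assms by (intro mult_left_mono) auto
    ultimately have "0 \<le> A * B - 2 * A * G * (\<rho> + x) - B * G * \<rho>\<^sup>2"
      using assms by (simp add: mult.assoc)
    then show ?thesis
      using x by simp
  qed
  finally have "cmod (of_real A + of_real B * c - of_real G * c\<^sup>2) ^ 2 \<le> (A + B * \<rho> - G * \<rho>\<^sup>2)\<^sup>2" .
  moreover have "0 \<le> A + B * \<rho> - G * \<rho>\<^sup>2"
  proof -
    have "G * \<rho>\<^sup>2 \<le> B * \<rho>"
      using \<rho> \<rho>2_le assms by (intro mult_mono) auto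
    then show ?thesis
      using assms by simp
  qed
  ultimately show ?thesis
    unfolding \<rho>_def by (rule power2_le_imp_le)
qed

text \<open>The expression is sorted by powers of \<open>e\<close> and each coefficient is bounded
  by its value at \<open>c = \<rho>\<close>. Nonnegativity of \<open>A\<close> and \<open>G\<close>
  comes from \<open>\<kappa> \<le> 1\<close>, that of the coefficient \<open>\<kappa> - 1/2\<close>
  in \<open>R1\<close> from \<open>1/2 \<le> \<kappa>\<close>.\<close>

lemma mcs_stability_disc:
  fixes c e :: complex and \<kappa> :: real
  assumes \<kappa>: "1/2 \<le> \<kappa>" "\<kappa> \<le> 1" and ce: "cmod c + cmod e \<le> 1"
  shows "cmod (1 - of_real \<kappa> * (1 - c - e) * (3 - c - of_real \<kappa> * (1 - c - e)) / 2) \<le> 1"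
proof -
  define \<rho> where "\<rho> = cmod c"
  define A B G where "A = (1 - \<kappa>) * (2 - \<kappa>) / 2" and "B = \<kappa> * (2 - \<kappa>)" and "G = \<kappa> * (1 - \<kappa>) / 2"
  define R0 where "R0 = of_real A + of_real B * c - of_real G * c\<^sup>2"
  define R1 where "R1 = of_real (3/2 - \<kappa>) + of_real (\<kappa> - 1/2) * c"
  have \<rho>: "0 \<le> \<rho>" "cmod e \<le> 1 - \<rho>" "\<rho> \<le> 1"
    unfolding \<rho>_def using ce norm_ge_zero[of c] norm_ge_zero[of e] by linarith+
  have R: "1 - of_real \<kappa> * (1 - c - e) * (3 - c - of_real \<kappa> * (1 - c - e)) / 2
      = R0 + e * (of_real \<kappa> * R1) + of_real (\<kappa>\<^sup>2 / 2) * e\<^sup>2"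
    by (simp add: R0_def R1_def A_def B_def G_def power2_eq_square field_simps)
  have R0: "cmod R0 \<le> A + B * \<rho> - G * \<rho>\<^sup>2"
    unfolding R0_def \<rho>_def
  proof (rule norm_quadratic_le)
    show "0 \<le> A" "0 \<le> B" "0 \<le> G"
      using \<kappa> by (auto simp: A_def B_def G_def)
    \<comment> \<open>Equality, because \<open>4 * A + B = (2 - \<kappa>)\<^sup>2\<close>.\<close>
    have "4 * A * G + B * G = A * B"
      by (simp add: A_def B_def G_def field_simps)
    then show "4 * A * G + B * G \<le> A * B"
      by simp
    have "G = \<kappa> * ((1 - \<kappa>) / 2)"
      by (simp add: G_def)
    also have "\<dots> \<le> B"
      unfolding B_def using \<kappa> by (intro mult_left_mono) (auto simp: field_simps)
    finally show "G \<le> B" .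
    show "cmod c \<le> 1"
      using \<rho> by (simp add: \<rho>_def)
  qed
  have R1: "cmod R1 \<le> (3/2 - \<kappa>) + (\<kappa> - 1/2) * \<rho>"
    using norm_triangle_ineq[of "of_real (3/2 - \<kappa>)" "of_real (\<kappa> - 1/2) * c"] \<kappa>
    by (simp only: R1_def norm_mult norm_of_real \<rho>_def)
  have "cmod (R0 + e * (of_real \<kappa> * R1) + of_real (\<kappa>\<^sup>2 / 2) * e\<^sup>2)
      \<le> cmod R0 + cmod (e * (of_real \<kappa> * R1)) + cmod (of_real (\<kappa>\<^sup>2 / 2) * e\<^sup>2)"
    by (meson norm_triangle_ineq order_trans add_right_mono)
  also have "\<dots> = cmod R0 + cmod e * (\<kappa> * cmod R1) + \<kappa>\<^sup>2 / 2 * (cmod e)\<^sup>2"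
    using \<kappa> by (simp add: norm_mult norm_power norm_divide)
  also have "\<dots> \<le> (A + B * \<rho> - G * \<rho>\<^sup>2) + (1 - \<rho>) * (\<kappa> * ((3/2 - \<kappa>) + (\<kappa> - 1/2) * \<rho>))
      + \<kappa>\<^sup>2 / 2 * (1 - \<rho>)\<^sup>2"
    using \<kappa> \<rho> by (intro add_mono mult_mono power_mono R0 R1) auto
  \<comment> \<open>The bound is the original expression at \<open>c = \<rho>\<close>,
    \<open>e = 1 - \<rho>\<close>, where the factor \<open>1 - c - e\<close> vanishes.\<close>
  also have "\<dots> = 1"
    by (simp add: A_def B_def G_def power2_eq_square field_simps)
  finally show ?thesis
    unfolding R .
qed

lemma norm_one_plus_squared:
  "(cmod (1 + X))\<^sup>2 = (cmod (1 - X))\<^sup>2 + 4 * Re X"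
  unfolding cmod_power2 by (simp add: power2_eq_square algebra_simps)

text \<open>Divided by \<open>cmod ((1 + X) * (1 + Y))\<close>, this becomes
  \<open>|c| + |e| \<le> 1\<close>. Real parts are differences of squared moduli,
  \<open>4 * Re X = m'\<^sup>2 - m\<^sup>2\<close>, so the claim follows from a reversed
  Cauchy-Schwarz inequality for the pairs \<open>(m', m)\<close> and \<open>(n', n)\<close>.\<close>

lemma cayley_product_bound:
  fixes X Y u :: complex
  assumes X: "0 \<le> Re X" and Y: "0 \<le> Re Y" and u: "cmod u \<le> 2 * sqrt (Re X * Re Y)"
  shows "cmod ((1 - X) * (1 - Y)) + 2 * cmod u \<le> cmod ((1 + X) * (1 + Y))"
proof -
  define m m' n n' where "m = cmod (1 - X)" and "m' = cmod (1 + X)"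
    and "n = cmod (1 - Y)" and "n' = cmod (1 + Y)"
  have nonneg: "0 \<le> m" "0 \<le> n"
    by (auto simp: m_def n_def)
  have m: "m'\<^sup>2 - m\<^sup>2 = 4 * Re X" and n: "n'\<^sup>2 - n\<^sup>2 = 4 * Re Y"
    by (simp_all add: m_def m'_def n_def n'_def norm_one_plus_squared)
  have "m\<^sup>2 \<le> m'\<^sup>2" "n\<^sup>2 \<le> n'\<^sup>2"
    using m n X Y by simp_all
  then have le: "m \<le> m'" "n \<le> n'"
    by (simp_all add: m_def m'_def n_def n'_def)
  have "(cmod u)\<^sup>2 \<le> (2 * sqrt (Re X * Re Y))\<^sup>2"
    by (intro power_mono u norm_ge_zero)
  then have "(2 * cmod u)\<^sup>2 \<le> (m'\<^sup>2 - m\<^sup>2) * (n'\<^sup>2 - n\<^sup>2)"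
    using X Y unfolding m n by (simp add: power_mult_distrib)
  \<comment> \<open>The difference of the two sides is
    \<open>(m' * n - m * n')\<^sup>2\<close>.\<close>
  also have "\<dots> \<le> (m' * n' - m * n)\<^sup>2"
    using zero_le_power2[of "m' * n - m * n'"] by (simp add: power2_eq_square algebra_simps)
  finally have "2 * cmod u \<le> m' * n' - m * n"
    by (rule power2_le_imp_le) (use le nonneg in \<open>auto intro: mult_mono\<close>)
  then show ?thesis
    by (simp add: norm_mult m_def m'_def n_def n'_def)
qed

lemma mcs_complex_bounds:
  fixes X Y u :: complex and \<kappa> :: real
  assumes X: "0 \<le> Re X" and Y: "0 \<le> Re Y" and u: "cmod u \<le> 2 * sqrt (Re X * Re Y)"
    and \<kappa>: "1/2 \<le> \<kappa>" "\<kappa> \<le> 1"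
  defines "P \<equiv> (1 + X) * (1 + Y)" and "W \<equiv> X + Y" and "V \<equiv> X + Y - u"
  shows "cmod ((P + W - of_real \<kappa> * V) / P\<^sup>2) \<le> 2"
    and "cmod (1 - 2 * (of_real \<kappa> * V) * (P + W - of_real \<kappa> * V) / P\<^sup>2) \<le> 1"
proof -
  define c e where "c = (1 - X) * (1 - Y) / P" and "e = 2 * u / P"
  have ge1: "1 \<le> cmod (1 + Z)" if "0 \<le> Re Z" for Z
    using that complex_Re_le_cmod[of "1 + Z"] by simp
  have P1: "1 \<le> cmod P"
    unfolding P_def norm_mult using mult_mono[OF ge1[OF X] ge1[OF Y]] by simp
  then have P0: "P \<noteq> 0"
    by auto
  have "cmod c + cmod e = (cmod ((1 - X) * (1 - Y)) + 2 * cmod u) / cmod P"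
    by (simp add: c_def e_def norm_divide norm_mult add_divide_distrib)
  also have "\<dots> \<le> 1"
    using P1 cayley_product_bound[OF X Y u] by (simp add: P_def[symmetric] divide_le_eq)
  finally have ce: "cmod c + cmod e \<le> 1" .
  \<comment> \<open>\<open>P\<close> minus the numerator of \<open>c\<close> is
    \<open>2 * (X + Y)\<close>.\<close>
  have W: "W / P = (1 - c) / 2"
    using P0 by (simp add: c_def field_simps) (simp add: P_def W_def algebra_simps)
  have V: "V / P = (1 - c - e) / 2"
  proof -
    have "V / P = W / P - e / 2"
      by (simp add: V_def W_def e_def diff_divide_distrib)
    then show ?thesis
      unfolding W by (simp add: diff_divide_distrib)
  qed
  have N: "(P + W - of_real \<kappa> * V) / P = (3 - c - of_real \<kappa> * (1 - c - e)) / 2"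
  proof -
    have "(P + W - of_real \<kappa> * V) / P = 1 + W / P - of_real \<kappa> * (V / P)"
      using P0 by (simp add: add_divide_distrib diff_divide_distrib)
    also have "\<dots> = (3 - c - of_real \<kappa> * (1 - c - e)) / 2"
      unfolding W V by (simp add: field_simps)
    finally show ?thesis .
  qed
  have "2 * (of_real \<kappa> * V) * (P + W - of_real \<kappa> * V) / P\<^sup>2
      = 2 * (of_real \<kappa> * (V / P)) * ((P + W - of_real \<kappa> * V) / P)"
    by (simp add: power2_eq_square)
  also have "\<dots> = of_real \<kappa> * (1 - c - e) * (3 - c - of_real \<kappa> * (1 - c - e)) / 2"
    unfolding V N by simp
  finally have R: "2 * (of_real \<kappa> * V) * (P + W - of_real \<kappa> * V) / P\<^sup>2 = \<dots>" .
  show "cmod (1 - 2 * (of_real \<kappa> * V) * (P + W - of_real \<kappa> * V) / P\<^sup>2) \<le> 1"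
    unfolding R by (rule mcs_stability_disc[OF \<kappa> ce])
  have "3 - c - of_real \<kappa> * (1 - c - e) = of_real (3 - \<kappa>) - of_real (1 - \<kappa>) * c + of_real \<kappa> * e"
    by (simp add: algebra_simps)
  also have "cmod \<dots> \<le> (3 - \<kappa>) + (1 - \<kappa>) * cmod c + \<kappa> * cmod e"
    using norm_triangle_ineq[of "of_real (3 - \<kappa>) - of_real (1 - \<kappa>) * c" "of_real \<kappa> * e"]
      norm_triangle_ineq4[of "of_real (3 - \<kappa>)" "of_real (1 - \<kappa>) * c"] \<kappa>
    by (simp only: norm_mult norm_of_real)
  \<comment> \<open>A coarse estimate suffices: with \<open>|c|\<close> and \<open>|e|\<close> each
    replaced by 1 the sum is \<open>4 - \<kappa>\<close>, and half of it is below 2. The remaining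
    division by \<open>P\<close> does no harm because \<open>1 \<le> cmod P\<close>.\<close>
  also have "\<dots> \<le> (3 - \<kappa>) + (1 - \<kappa>) * 1 + \<kappa> * 1"
    using \<kappa> ce norm_ge_zero[of c] norm_ge_zero[of e]
    by (intro add_mono mult_left_mono) (linarith | simp)+
  finally have N2: "cmod ((P + W - of_real \<kappa> * V) / P) \<le> 2"
    unfolding N using \<kappa> by (simp add: norm_divide)
  have "cmod ((P + W - of_real \<kappa> * V) / P\<^sup>2) = cmod ((P + W - of_real \<kappa> * V) / P) / cmod P"
    by (simp add: norm_divide norm_mult power2_eq_square)
  also have "\<dots> \<le> 2 / 1"
    by (intro frac_le N2 P1) auto
  finally show "cmod ((P + W - of_real \<kappa> * V) / P\<^sup>2) \<le> 2"
    by simp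
qed

section \<open>Return to the scheme and conclusion\<close>

text \<open>Both sides of the condition are homogeneous of degree 1, so scaling by \<theta>
  preserves it; the sign change moves \<open>z1\<close> and \<open>z2\<close> to the right
  half-plane.\<close>

lemma mcs_cond_scaled:
  assumes "\<theta> > 0" and cond: "mcs_cond z0 z1 z2"
  shows "0 \<le> Re (- (of_real \<theta> * z1))" "0 \<le> Re (- (of_real \<theta> * z2))"
    and "cmod (of_real \<theta> * z0) \<le> 2 * sqrt (Re (- (of_real \<theta> * z1)) * Re (- (of_real \<theta> * z2)))"
proof -
  show "0 \<le> Re (- (of_real \<theta> * z1))" "0 \<le> Re (- (of_real \<theta> * z2))"
    using assms by (auto simp: mcs_cond_def mult_nonneg_nonpos)
  have "sqrt (Re (- (of_real \<theta> * z1)) * Re (- (of_real \<theta> * z2))) = sqrt (\<theta>\<^sup>2 * (Re z1 * Re z2))"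
    by (simp add: power2_eq_square ac_simps)
  also have "\<dots> = \<theta> * sqrt (Re z1 * Re z2)"
    using assms(1) by (simp add: real_sqrt_mult)
  finally show "cmod (of_real \<theta> * z0) \<le> 2 * sqrt (Re (- (of_real \<theta> * z1)) * Re (- (of_real \<theta> * z2)))"
    using assms by (simp add: norm_mult mcs_cond_def mult.left_commute)
qed

lemma mcs_real_stable:
  fixes \<theta> z0 z1 z2 :: real
  assumes \<theta>: "1/3 \<le> \<theta>" and cond: "mcs_cond (of_real z0) (of_real z1) (of_real z2)"
  shows "cmod (1 + (of_real z0 + of_real z1 + of_real z2)
      * mcs_factor \<theta> (of_real z0) (of_real z1) (of_real z2)) \<le> 1"
    and "cmod (mcs_factor \<theta> (of_real z0) (of_real z1) (of_real z2)) \<le> 2"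
proof -
  \<comment> \<open>For positive \<theta>, \<open>1/3 \<le> \<theta>\<close> is exactly
    \<open>\<kappa> \<le> 3/2\<close>.\<close>
  have pos: "\<theta> > 0" and \<kappa>: "0 \<le> 1 / (2 * \<theta>)" "1 / (2 * \<theta>) \<le> 3/2"
    using \<theta> by (auto simp: field_simps)
  define x y u where "x = - (\<theta> * z1)" and "y = - (\<theta> * z2)" and "u = \<theta> * z0"
  define P where "P = (1 + x) * (1 + y)"
  define N where "N = P + (x + y) - 1 / (2 * \<theta>) * (x + y - u)"
  have xy: "0 \<le> x" "0 \<le> y" "\<bar>u\<bar> \<le> 2 * sqrt (x * y)"
    using mcs_cond_scaled[OF pos cond] pos by (auto simp: x_def y_def u_def norm_mult abs_mult)
  have p: "mcs_p \<theta> (of_real z1) (of_real z2) = of_real P"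
    by (simp add: mcs_p_def P_def x_def y_def)
  have W: "- (of_real \<theta> * (of_real z1 + of_real z2)) = complex_of_real (x + y)"
    and V: "- (of_real \<theta> * (of_real z0 + of_real z1 + of_real z2)) = complex_of_real (x + y - u)"
    by (simp_all add: x_def y_def u_def algebra_simps)
  note scaled = mcs_factor_scaled[OF pos, of "of_real z0" "of_real z1" "of_real z2", unfolded p W V]
  note bounds = mcs_real_bounds[OF xy \<kappa>, folded P_def, folded N_def]
  have S: "mcs_factor \<theta> (of_real z0) (of_real z1) (of_real z2) = of_real (N / P\<^sup>2)"
    unfolding scaled(1) N_def by simp
  have R: "1 + (of_real z0 + of_real z1 + of_real z2)
        * mcs_factor \<theta> (of_real z0) (of_real z1) (of_real z2)
      = of_real (1 - 2 * (1 / (2 * \<theta>) * (x + y - u)) * N / P\<^sup>2)"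
    unfolding scaled(2) N_def by simp
  show "cmod (1 + (of_real z0 + of_real z1 + of_real z2)
      * mcs_factor \<theta> (of_real z0) (of_real z1) (of_real z2)) \<le> 1"
    unfolding R norm_of_real by (rule bounds(2))
  show "cmod (mcs_factor \<theta> (of_real z0) (of_real z1) (of_real z2)) \<le> 2"
    unfolding S norm_of_real by (rule bounds(1))
qed

lemma mcs_complex_stable:
  assumes \<theta>: "1/2 \<le> \<theta>" "\<theta> \<le> 1" and cond: "mcs_cond z0 z1 z2"
  shows "cmod (1 + (z0 + z1 + z2) * mcs_factor \<theta> z0 z1 z2) \<le> 1"
    and "cmod (mcs_factor \<theta> z0 z1 z2) \<le> 2"
proof -
  \<comment> \<open>Inversion maps the range \<open>1/2 \<le> \<theta> \<le> 1\<close> onto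
    \<open>1/2 \<le> \<kappa> \<le> 1\<close>.\<close>
  have pos: "\<theta> > 0" and \<kappa>: "1/2 \<le> 1 / (2 * \<theta>)" "1 / (2 * \<theta>) \<le> 1"
    using \<theta> by (auto simp: field_simps)
  define X Y u where "X = - (of_real \<theta> * z1)" and "Y = - (of_real \<theta> * z2)" and "u = of_real \<theta> * z0"
  have p: "mcs_p \<theta> z1 z2 = (1 + X) * (1 + Y)"
    by (simp add: mcs_p_def X_def Y_def)
  have W: "- (of_real \<theta> * (z1 + z2)) = X + Y"
    and V: "- (of_real \<theta> * (z0 + z1 + z2)) = X + Y - u"
    by (simp_all add: X_def Y_def u_def algebra_simps)
  note scaled = mcs_factor_scaled[OF pos, of z0 z1 z2, unfolded p W V]
  note bounds = mcs_complex_bounds[OF mcs_cond_scaled[OF pos cond] \<kappa>, folded X_def Y_def u_def]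
  show "cmod (1 + (z0 + z1 + z2) * mcs_factor \<theta> z0 z1 z2) \<le> 1"
    unfolding scaled(2) by (rule bounds(2))
  show "cmod (mcs_factor \<theta> z0 z1 z2) \<le> 2"
    unfolding scaled(1) by (rule bounds(1))
qed

theorem theorem7:
  fixes \<theta> lam T \<Delta>t L M :: real and n :: nat
  assumes "\<theta> > 0" and "lam > 0" and "T > 0" and "\<Delta>t > 0"
    and "n \<ge> 1" and "real n * \<Delta>t \<le> T"
  defines "L \<equiv> max (1 / \<theta>) 2"
  defines "M \<equiv> exp (2 * L * lam * T)"
  shows "(\<theta> \<ge> 1/3 \<longrightarrow>
            (\<forall>w0::complex. \<forall>z0 z1 z2 :: real.
               cmod w0 \<le> lam * \<Delta>t \<longrightarrow>
               mcs_cond (of_real z0) (of_real z1) (of_real z2) \<longrightarrow>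
               mat_maxnorm (matpow (mcs_companion \<theta> w0 (of_real z0) (of_real z1) (of_real z2)) n) \<le> M))
       \<and> (1/2 \<le> \<theta> \<and> \<theta> \<le> 1 \<longrightarrow>
            (\<forall>w0 z0 z1 z2 :: complex.
               cmod w0 \<le> lam * \<Delta>t \<longrightarrow>
               mcs_cond z0 z1 z2 \<longrightarrow>
               mat_maxnorm (matpow (mcs_companion \<theta> w0 z0 z1 z2) n) \<le> M))"
proof -
  have L: "2 \<le> L"
    by (simp add: L_def)
  have "2 * L * (real n * (lam * \<Delta>t)) = 2 * L * lam * (real n * \<Delta>t)"
    by simp
  also have "\<dots> \<le> 2 * L * lam * T"
    using assms L by (intro mult_left_mono) auto
  finally have M: "exp (2 * L * (real n * (lam * \<Delta>t))) \<le> M"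
    by (simp add: M_def)
  \<comment> \<open>Both parts reduce to this claim: in either parameter range the factor is bounded
    by 2, hence by \<open>L\<close>.\<close>
  have "mat_maxnorm (matpow (mcs_companion \<theta> w0 z0 z1 z2) n) \<le> M"
    if "cmod (1 + (z0 + z1 + z2) * mcs_factor \<theta> z0 z1 z2) \<le> 1"
      "cmod (mcs_factor \<theta> z0 z1 z2) \<le> 2" "cmod w0 \<le> lam * \<Delta>t"
    for w0 z0 z1 z2
    using mcs_companion_matpow_le[OF that(1) order_trans[OF that(2) L] that(3)] M
    by (rule order_trans)
  then show ?thesis
    using mcs_real_stable mcs_complex_stable by blast
qed

end
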